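(* Let $n\ge 1$, let $\mathrm{id}\in S_n$ be the identity and let $\varphi:\mathbb{Z}_n\to\mathbb{Z}_n$ be the involution $\varphi(i)=(n-1)-i$. Let $f\in\mathbb{Z}_n^{\mathbb{Z}_n}$. Then $G_f$ is graceful if and only if there exist a nonempty set $\mathcal{G}\subset S_n$ and a sign function $\mathfrak{s}:\mathcal{G}\times\mathbb{Z}_n\to\{-1,0,1\}$ such that for every $\gamma\in\mathcal{G}$ there is a coset representative $\sigma_\gamma\in S_n/\mathrm{Aut}(G_f)$ with \[ f(i)=\sigma_\gamma^{(-1)}\Big(\varphi^{(t)}\big(\varphi^{(t)}(\sigma_\gamma(i))+(-1)^t\,\mathfrak{s}(\gamma,\sigma_\gamma(i))\,\gamma(\sigma_\gamma(i))\big)\Big)\quad\text{for all } i\in\mathbb{Z}_n \text{ and } t\in\{0,1\}, \] i.e. $f=\sigma_\gamma^{(-1)}\varphi^{(t)}\big(\varphi^{(t)}\sigma_\gamma+(-1)^t\,\mathfrak{s}(\gamma,\sigma_\gamma)\cdot\gamma\sigma_\gamma\big)$ for all $\gamma\in\mathcal{G}$, $t\in\{0,1\}$.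
   Context: $\mathbb{Z}_n:=\{0,1,\dots,n-1\}$ (a set of integers; arithmetic is ordinary integer arithmetic). $\mathbb{Z}_n^{\mathbb{Z}_n}$ is the set of all maps $\mathbb{Z}_n\to\mathbb{Z}_n$, composition is written by juxtaposition, $S_n\subset\mathbb{Z}_n^{\mathbb{Z}_n}$ is the symmetric group, $\sigma^{(-1)}$ is the inverse permutation, $h^{(0)}=\mathrm{id}$ and $h^{(k+1)}=h\circ h^{(k)}$. For $f\in\mathbb{Z}_n^{\mathbb{Z}_n}$, the functional directed graph $G_f$ has vertex set $\mathbb{Z}_n$ and directed edge set $\{(i,f(i)):i\in\mathbb{Z}_n\}$. $G_f$ is graceful if there is a bijection $\sigma\in S_n$ with $\{|\sigma f\sigma^{(-1)}(i)-i|:i\in\mathbb{Z}_n\}=\mathbb{Z}_n$. $\mathrm{Aut}(G_f)\subseteq S_n$ is the automorphism group of $G_f$, i.e. the permutations $\sigma$ with $\sigma f\sigma^{(-1)}=f$; a coset representative in $S_n/\mathrm{Aut}(G_f)$ is any element of $S_n$ chosen to represent a (left) coset of $\mathrm{Aut}(G_f)$.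
   Formalization: The sign function is additionally required to vanish at (γ, j) only where γ(j) = 0; with an arbitrary sign function the "if" direction fails, e.g. n = 2, f = id, 𝒢 = {id}, 𝔰 = 0, σ = id. The inclusion 𝒢 ⊂ S_n is read as non-strict. *)

theory Defs
  imports "HOL-Combinatorics.Permutations" "HOL-Library.FuncSet"
begin

definition Zn :: "nat \<Rightarrow> int set" where
  "Zn n = {0..<int n}"

text \<open>
  Permutations of \<open>Zn n\<close> are total functions that fix every integer outside \<open>Zn n\<close>, so that
  composition is \<open>\<circ>\<close> and the inverse is \<open>inv\<close>. In particular \<open>inv \<sigma> x \<in> Zn n\<close> holds only
  if \<open>x \<in> Zn n\<close>.
\<close>

definition Sn :: "nat \<Rightarrow> (int \<Rightarrow> int) set" where
  "Sn n = {\<sigma>. \<sigma> permutes Zn n}"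

text \<open>
  The functional digraph of \<open>f\<close> is determined by \<open>n\<close> and the restriction of \<open>f\<close> to \<open>Zn n\<close>. The
  notions below are therefore indexed by \<open>n\<close> and \<open>f\<close>, and ignore the values of \<open>f\<close> outside \<open>Zn n\<close>.
\<close>

definition graceful :: "nat \<Rightarrow> (int \<Rightarrow> int) \<Rightarrow> bool" where
  "graceful n f \<longleftrightarrow> (\<exists>\<sigma>\<in>Sn n. (\<lambda>i. \<bar>(\<sigma> \<circ> f \<circ> inv \<sigma>) i - i\<bar>) ` Zn n = Zn n)"

definition Aut :: "nat \<Rightarrow> (int \<Rightarrow> int) \<Rightarrow> (int \<Rightarrow> int) set" where
  "Aut n f = {\<sigma> \<in> Sn n. \<forall>i\<in>Zn n. (\<sigma> \<circ> f \<circ> inv \<sigma>) i = f i}"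

definition left_cosets :: "nat \<Rightarrow> (int \<Rightarrow> int) \<Rightarrow> (int \<Rightarrow> int) set set" where
  "left_cosets n f = (\<lambda>\<sigma>. (\<lambda>\<alpha>. \<sigma> \<circ> \<alpha>) ` Aut n f) ` Sn n"

definition coset_representative :: "nat \<Rightarrow> (int \<Rightarrow> int) \<Rightarrow> (int \<Rightarrow> int) \<Rightarrow> bool" where
  "coset_representative n f \<sigma> \<longleftrightarrow> (\<exists>C\<in>left_cosets n f. \<sigma> \<in> C)"

text \<open>
  Only the values on \<open>Zn n\<close> and the equivalence of \<open>x \<in> Zn n\<close> and \<open>\<phi> n x \<in> Zn n\<close> matter.
\<close>

definition \<phi> :: "nat \<Rightarrow> int \<Rightarrow> int" where
  "\<phi> n i = (int n - 1) - i"

text \<open>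
  \<open>s (\<gamma>, j)\<close> is the sign attached to the magnitude \<open>\<gamma> j \<ge> 0\<close>, so the sign \<open>0\<close> is reserved for
  magnitude \<open>0\<close>. Without the second conjunct \<open>s\<close> could be constantly \<open>0\<close>; this would allow
  \<open>f = id\<close> with \<open>n \<ge> 2\<close> (take \<open>\<gamma> = \<sigma> = id\<close>), whose digraph is not graceful.
\<close>

definition sign_function ::
  "nat \<Rightarrow> (int \<Rightarrow> int) set \<Rightarrow> ((int \<Rightarrow> int) \<times> int \<Rightarrow> int) \<Rightarrow> bool" where
  "sign_function n G s \<longleftrightarrow>
     s \<in> G \<times> Zn n \<rightarrow> {-1, 0, 1} \<and>
     (\<forall>\<gamma>\<in>G. \<forall>j\<in>Zn n. s (\<gamma>, j) = 0 \<longrightarrow> \<gamma> j = 0)"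

end

theory Submission
  imports Defs
begin

text \<open>
  Both values of \<open>t\<close> give the same equation \<open>\<sigma> (f i) = \<sigma> i + s (\<gamma>, \<sigma> i) * \<gamma> (\<sigma> i)\<close>, which says
  that \<open>\<gamma>\<close> and \<open>s\<close> are the absolute value and the sign of the displacement \<open>j \<mapsto> \<sigma> f \<sigma>\<^sup>-\<^sup>1 j - j\<close>.
  Gracefulness means that the absolute displacement is onto the finite set \<open>Zn n\<close> for some \<open>\<sigma>\<close>,
  hence that it is a permutation.
\<close>

text \<open>The identity is an automorphism, so every permutation lies in its own coset. Choosing
  representatives therefore does not restrict \<open>\<sigma>\<close>.\<close>

lemma coset_representative_iff: "coset_representative n f \<sigma> \<longleftrightarrow> \<sigma> \<in> Sn n"
proof
  assume "coset_representative n f \<sigma>"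
  then obtain \<tau> \<alpha> where "\<tau> \<in> Sn n" "\<alpha> \<in> Aut n f" "\<sigma> = \<tau> \<circ> \<alpha>"
    unfolding coset_representative_def left_cosets_def by blast
  then show "\<sigma> \<in> Sn n"
    by (auto simp: Aut_def Sn_def intro: permutes_compose)
next
  assume "\<sigma> \<in> Sn n"
  moreover have "id \<in> Aut n f"
    by (simp add: Aut_def Sn_def permutes_id)
  ultimately show "coset_representative n f \<sigma>"
    unfolding coset_representative_def left_cosets_def by (force intro: image_eqI[of _ _ id])
qed

text \<open>The reflection \<open>\<phi> n\<close> is an involution that negates differences, so for
  \<open>t = 1\<close> the two sign changes cancel: reflecting \<open>\<phi> n x - a * b\<close>
  gives \<open>x + a * b\<close>.\<close>

lemma signed_displacement_iff:
  assumes "\<sigma> \<in> Sn n"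
  shows "(\<forall>t\<in>{0, 1::nat}. y = inv \<sigma> ((\<phi> n ^^ t) ((\<phi> n ^^ t) x + (-1) ^ t * a * b)))
    \<longleftrightarrow> \<sigma> y = x + a * b"
proof -
  have "bij \<sigma>"
    using assms by (simp add: Sn_def permutes_bij)
  then have "y = inv \<sigma> z \<longleftrightarrow> \<sigma> y = z" for z
    by (metis bij_inv_eq_iff)
  then show ?thesis
    by (simp add: \<phi>_def algebra_simps)
qed

text \<open>Reindexing by \<open>\<sigma>\<close>, which maps \<open>Zn n\<close> onto itself,
  removes the inverse.\<close>

lemma graceful_iff_displacement:
  "graceful n f \<longleftrightarrow> (\<exists>\<sigma>\<in>Sn n. (\<lambda>i. \<bar>\<sigma> (f i) - \<sigma> i\<bar>) ` Zn n = Zn n)"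
proof -
  have "(\<lambda>i. \<bar>(\<sigma> \<circ> f \<circ> inv \<sigma>) i - i\<bar>) ` Zn n = (\<lambda>i. \<bar>\<sigma> (f i) - \<sigma> i\<bar>) ` Zn n"
    if "\<sigma> \<in> Sn n" for \<sigma>
  proof -
    have "\<sigma> permutes Zn n"
      using that by (simp add: Sn_def)
    then have "(\<lambda>i. \<bar>(\<sigma> \<circ> f \<circ> inv \<sigma>) i - i\<bar>) ` (\<sigma> ` Zn n) = (\<lambda>i. \<bar>\<sigma> (f i) - \<sigma> i\<bar>) ` Zn n"
      by (simp add: image_image permutes_inverses)
    then show ?thesis
      using \<open>\<sigma> permutes Zn n\<close> by (simp add: permutes_image)
  qed
  then show ?thesis
    by (simp add: graceful_def)
qed

theorem theorem1:
  fixes n :: nat and f :: "int \<Rightarrow> int"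
  assumes "n \<ge> 1"
    and "f \<in> Zn n \<rightarrow> Zn n"
  shows "graceful n f \<longleftrightarrow>
    (\<exists>G s. G \<noteq> {} \<and> G \<subseteq> Sn n \<and> sign_function n G s \<and>
      (\<forall>\<gamma>\<in>G. \<exists>\<sigma>. coset_representative n f \<sigma> \<and>
        (\<forall>i\<in>Zn n. \<forall>t\<in>{0, 1::nat}.
          f i = inv \<sigma> ((\<phi> n ^^ t)
            ((\<phi> n ^^ t) (\<sigma> i) + (-1) ^ t * s (\<gamma>, \<sigma> i) * \<gamma> (\<sigma> i))))))"
    (is "_ \<longleftrightarrow> ?R")
proof -
  have R: "?R \<longleftrightarrow> (\<exists>G s. G \<noteq> {} \<and> G \<subseteq> Sn n \<and> sign_function n G s \<and>
      (\<forall>\<gamma>\<in>G. \<exists>\<sigma>\<in>Sn n. \<forall>i\<in>Zn n. \<sigma> (f i) = \<sigma> i + s (\<gamma>, \<sigma> i) * \<gamma> (\<sigma> i)))"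
    \<comment> \<open>Folding into a bounded quantifier lets \<open>bex_cong\<close> supply
      \<open>\<sigma> \<in> Sn n\<close>, the premise of the rewrite rule.\<close>
    unfolding coset_representative_iff Bex_def[symmetric]
    by (simp only: signed_displacement_iff cong: bex_cong)
  show ?thesis
    unfolding R
  proof
    assume "graceful n f"
    then obtain \<sigma> where \<sigma>: "\<sigma> permutes Zn n"
      and onto: "(\<lambda>i. \<bar>\<sigma> (f i) - \<sigma> i\<bar>) ` Zn n = Zn n"
      unfolding graceful_iff_displacement Sn_def by blast
    define d where "d j = \<sigma> (f (inv \<sigma> j)) - j" for j
    \<comment> \<open>Elements of \<open>Sn n\<close> must fix every integer outside
      \<open>Zn n\<close>, hence the second branch.\<close>
    define \<gamma> where "\<gamma> j = (if j \<in> Zn n then \<bar>d j\<bar> else j)" for j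
    \<comment> \<open>The first argument can be ignored because \<open>G\<close> will be the
      singleton of \<open>\<gamma>\<close>. The value \<open>0\<close> occurs only where the
      displacement vanishes.\<close>
    define s :: "(int \<Rightarrow> int) \<times> int \<Rightarrow> int" where "s = (\<lambda>(_, j). sgn (d j))"
    have d: "d (\<sigma> i) = \<sigma> (f i) - \<sigma> i" for i
      using \<sigma> by (simp add: d_def permutes_inverses)
    have "\<gamma> ` Zn n = (\<lambda>j. \<bar>d j\<bar>) ` (\<sigma> ` Zn n)"
      by (simp add: \<gamma>_def permutes_image[OF \<sigma>])
    also have "\<dots> = Zn n"
      using onto by (simp add: image_image d)
    finally have "\<gamma> ` Zn n = Zn n" .
    then have "bij_betw \<gamma> (Zn n) (Zn n)"
      by (simp add: bij_betw_def eq_card_imp_inj_on Zn_def)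
    then have "\<gamma> \<in> Sn n"
      unfolding Sn_def by (simp add: bij_imp_permutes \<gamma>_def)
    moreover have "sign_function n {\<gamma>} s"
      by (auto simp: sign_function_def s_def \<gamma>_def sgn_if split: if_splits)
    moreover have "\<sigma> (f i) = \<sigma> i + s (\<gamma>, \<sigma> i) * \<gamma> (\<sigma> i)" if "i \<in> Zn n" for i
      using that \<sigma> by (simp add: s_def \<gamma>_def permutes_in_image d sgn_mult_abs)
    ultimately show "\<exists>G s. G \<noteq> {} \<and> G \<subseteq> Sn n \<and> sign_function n G s \<and>
      (\<forall>\<gamma>\<in>G. \<exists>\<sigma>\<in>Sn n. \<forall>i\<in>Zn n. \<sigma> (f i) = \<sigma> i + s (\<gamma>, \<sigma> i) * \<gamma> (\<sigma> i))"
      using \<sigma> by (intro exI[of _ "{\<gamma>}"] exI[of _ s]) (auto simp: Sn_def)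
  next
    assume "\<exists>G s. G \<noteq> {} \<and> G \<subseteq> Sn n \<and> sign_function n G s \<and>
      (\<forall>\<gamma>\<in>G. \<exists>\<sigma>\<in>Sn n. \<forall>i\<in>Zn n. \<sigma> (f i) = \<sigma> i + s (\<gamma>, \<sigma> i) * \<gamma> (\<sigma> i))"
    \<comment> \<open>A single \<open>\<gamma>\<close> from the nonempty \<open>G\<close> already
      yields a graceful labelling.\<close>
    then obtain G s \<gamma> \<sigma> where s: "sign_function n G s" and G: "\<gamma> \<in> G"
      and \<gamma>: "\<gamma> permutes Zn n" and \<sigma>: "\<sigma> permutes Zn n"
      and eq: "\<And>i. i \<in> Zn n \<Longrightarrow> \<sigma> (f i) = \<sigma> i + s (\<gamma>, \<sigma> i) * \<gamma> (\<sigma> i)"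
      unfolding Sn_def by blast
    \<comment> \<open>Values of \<open>\<gamma>\<close> on \<open>Zn n\<close> are nonnegative, so a
      sign of \<open>1\<close> or \<open>-1\<close> disappears under the absolute value. A sign of
      \<open>0\<close> forces magnitude \<open>0\<close>, so both sides vanish.\<close>
    have "\<bar>\<sigma> (f i) - \<sigma> i\<bar> = \<gamma> (\<sigma> i)" if i: "i \<in> Zn n" for i
    proof -
      have j: "\<sigma> i \<in> Zn n"
        using i \<sigma> by (simp add: permutes_in_image)
      then have "0 \<le> \<gamma> (\<sigma> i)"
        using permutes_in_image[OF \<gamma>, of "\<sigma> i"] by (simp add: Zn_def)
      moreover have "s (\<gamma>, \<sigma> i) \<in> {-1, 0, 1}" "s (\<gamma>, \<sigma> i) = 0 \<longrightarrow> \<gamma> (\<sigma> i) = 0"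
        using s G j unfolding sign_function_def by blast+
      ultimately show ?thesis
        using eq[OF i] by auto
    qed
    then have "(\<lambda>i. \<bar>\<sigma> (f i) - \<sigma> i\<bar>) ` Zn n = \<gamma> ` \<sigma> ` Zn n"
      by (simp add: image_image)
    also have "\<dots> = Zn n"
      using \<gamma> \<sigma> by (simp add: permutes_image)
    finally show "graceful n f"
      using \<sigma> unfolding graceful_iff_displacement Sn_def by blast
  qed
qed

end
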